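(* Let $A=\{0,1\}$, let $\rho=\{(0,0),(0,1),(1,1)\}\subseteq A^2$ be the natural order, and let $\mathcal{M}=\mathrm{Pol}\,\rho$ be the clone of monotone Boolean functions. Then the generalized quasiorders on $A$ coincide with the (nonempty) invariant relations of $\mathcal{M}$: $$\mathrm{gQuord}(A)=\mathrm{Inv}\,\mathcal{M}=[\rho]_{(\land,=)}.$$
   Context: All operations $f:A^n\to A$ and relations $\sigma\subseteq A^m$ have finite arity $n,m\ge 1$. An operation $f:A^n\to A$ preserves $\sigma\subseteq A^m$ if applying $f$ componentwise to any $r_1,\dots,r_n\in\sigma$ gives a tuple in $\sigma$. $\mathrm{Pol}\,\rho$ is the set of all finitary operations on $A$ preserving $\rho$. For a set $F$ of operations, $\mathrm{Inv}\,F$ is the set of all nonempty relations on $A$ (of all arities) preserved by every $f\in F$. A relation $\sigma\subseteq A^m$ is reflexive if $(a,\dots,a)\in\sigma$ for all $a\in A$; it is (generalized) transitive if for every matrix $(a_{ij})\in A^{m\times m}$ all of whose rows and all of whose columns belong to $\sigma$, the diagonal $(a_{11},\dots,a_{mm})$ belongs to $\sigma$. A generalized quasiorder is a reflexive and transitive relation $\sigma\subseteq A^m$ for some $m\ge1$; $\mathrm{gQuord}(A)$ is the set of all of them (all arities). $[\rho]_{(\land,=)}$ is the set of all relations $\{(a_1,\dots,a_m)\in A^m\mid \varphi(a_1,\dots,a_m)\}$, $m\ge1$, where $\varphi(x_1,\dots,x_m)$ is a finite conjunction of atomic formulas of the form $(x_i,x_j)\in\rho$ or $x_i=x_j$. 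*)

theory Defs
  imports Main "HOL-Library.FuncSet"
begin

text \<open>
  The base set is the universe of the type \<open>'a\<close>, and an \<open>m\<close>-tuple is a list of length \<open>m\<close>.
  Operations and relations carry their arity explicitly. Indices run over \<open>0, ..., m - 1\<close>.
\<close>

type_synonym 'a opn = "nat \<times> ('a list \<Rightarrow> 'a)"
type_synonym 'a reln = "nat \<times> 'a list set"

definition tuples :: "nat \<Rightarrow> 'a list set" where
  "tuples m = {xs. length xs = m}"

text \<open>
  Operations are extensional (\<open>undefined\<close> off \<open>tuples n\<close>), so that a pair \<open>(n, f)\<close> is the same
  thing as a function from \<open>n\<close>-tuples to the base set.
\<close>

definition operations :: "'a opn set" where
  "operations = {(n, f). n \<ge> 1 \<and> f \<in> tuples n \<rightarrow>\<^sub>E UNIV}"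

definition relations :: "'a reln set" where
  "relations = {(m, \<sigma>). m \<ge> 1 \<and> \<sigma> \<subseteq> tuples m}"

definition componentwise :: "('a list \<Rightarrow> 'a) \<Rightarrow> nat \<Rightarrow> 'a list list \<Rightarrow> 'a list" where
  "componentwise f m rs = map (\<lambda>i. f (map (\<lambda>r. r ! i) rs)) [0..<m]"

fun preserves :: "'a opn \<Rightarrow> 'a reln \<Rightarrow> bool" where
  "preserves (n, f) (m, \<sigma>) \<longleftrightarrow>
     (\<forall>rs. length rs = n \<and> set rs \<subseteq> \<sigma> \<longrightarrow> componentwise f m rs \<in> \<sigma>)"

definition Pol :: "'a reln \<Rightarrow> 'a opn set" where
  "Pol R = {f \<in> operations. preserves f R}"

definition Inv :: "'a opn set \<Rightarrow> 'a reln set" where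
  "Inv F = {(m, \<sigma>) \<in> relations. \<sigma> \<noteq> {} \<and> (\<forall>f\<in>F. preserves f (m, \<sigma>))}"

fun reflexive :: "'a reln \<Rightarrow> bool" where
  "reflexive (m, \<sigma>) \<longleftrightarrow> (\<forall>a. replicate m a \<in> \<sigma>)"

fun gen_transitive :: "'a reln \<Rightarrow> bool" where
  "gen_transitive (m, \<sigma>) \<longleftrightarrow>
     (\<forall>a :: nat \<Rightarrow> nat \<Rightarrow> 'a.
        (\<forall>i<m. map (\<lambda>j. a i j) [0..<m] \<in> \<sigma>) \<and>
        (\<forall>j<m. map (\<lambda>i. a i j) [0..<m] \<in> \<sigma>) \<longrightarrow>
        map (\<lambda>i. a i i) [0..<m] \<in> \<sigma>)"

definition gQuord :: "'a reln set" where
  "gQuord = {R \<in> relations. reflexive R \<and> gen_transitive R}"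

text \<open>
  \<open>InRel i j\<close> stands for the atomic formula \<open>(x\<^sub>i, x\<^sub>j) \<in> \<rho>\<close>, with \<open>\<rho>\<close> a binary relation, and
  \<open>Equal i j\<close> for \<open>x\<^sub>i = x\<^sub>j\<close>. A finite conjunction is given by the list of its conjuncts; the empty
  list defines the same relation as the conjunction with the single conjunct \<open>Equal 0 0\<close>.
\<close>

datatype atom = InRel nat nat | Equal nat nat

fun atom_vars :: "atom \<Rightarrow> nat set" where
  "atom_vars (InRel i j) = {i, j}"
| "atom_vars (Equal i j) = {i, j}"

fun holds :: "'a list set \<Rightarrow> 'a list \<Rightarrow> atom \<Rightarrow> bool" where
  "holds \<rho> as (InRel i j) \<longleftrightarrow> [as ! i, as ! j] \<in> \<rho>"
| "holds \<rho> as (Equal i j) \<longleftrightarrow> as ! i = as ! j"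

definition conj_eq_definable :: "'a list set \<Rightarrow> 'a reln set" where
  "conj_eq_definable \<rho> =
     {(m, {as \<in> tuples m. \<forall>\<alpha>\<in>set \<phi>. holds \<rho> as \<alpha>}) | m \<phi>.
        m \<ge> 1 \<and> (\<forall>\<alpha>\<in>set \<phi>. atom_vars \<alpha> \<subseteq> {..<m})}"

end

(* Each of the three sets consists of the sublattices of {0,1}^m containing both constant tuples.
   For a generalized quasiorder, the matrix (x_i \<and> y_j) has rows equal to y or the constant 0 tuple
   and columns equal to x or the constant 0 tuple, so its diagonal, the meet of x and y, belongs to
   the relation; the matrix (x_i \<or> y_j) gives the join. For Inv M, meet, join and the constants are
   themselves monotone. Conversely, such a sublattice is defined by the implications between
   coordinates that hold throughout it: a tuple x satisfying them is a join of meets of members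
   that separate an index i with x_i = 1 from an index j with x_j = 0. *)
theory Submission
  imports Defs
begin

abbreviation bool_order :: "bool list set" where
  "bool_order \<equiv> {[False, False], [False, True], [True, True]}"

lemma mem_bool_order_iff [simp]: "[a, b] \<in> bool_order \<longleftrightarrow> a \<le> b"
  by auto

definition bounded_sublattices :: "bool reln set" where
  "bounded_sublattices = {(m, \<sigma>) \<in> relations. (\<forall>a. replicate m a \<in> \<sigma>) \<and>
     (\<forall>x\<in>\<sigma>. \<forall>y\<in>\<sigma>. map2 (\<and>) x y \<in> \<sigma> \<and> map2 (\<or>) x y \<in> \<sigma>)}"

lemma preserves_bool_order_iff:
  "preserves (n, f) (2, bool_order) \<longleftrightarrow>
     (\<forall>xs ys. length xs = n \<and> list_all2 (\<le>) xs ys \<longrightarrow> f xs \<le> f ys)" (is "?L \<longleftrightarrow> ?R")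
proof
  assume L: ?L
  show ?R
  proof (intro allI impI, elim conjE)
    fix xs ys :: "bool list"
    assume len: "length xs = n" and le: "list_all2 (\<le>) xs ys"
    define rs where "rs = map2 (\<lambda>x y. [x, y]) xs ys"
    have "length ys = n"
      using len le by (simp add: list_all2_lengthD)
    then have cols: "map (\<lambda>r. r ! 0) rs = xs" "map (\<lambda>r. r ! 1) rs = ys" and "length rs = n"
      using len by (auto simp: rs_def intro!: nth_equalityI)
    moreover have "set rs \<subseteq> bool_order"
      using le by (auto simp: rs_def list_all2_iff)
    ultimately have "componentwise f 2 rs \<in> bool_order"
      using L by (simp only: preserves.simps)
    moreover have "componentwise f 2 rs = [f xs, f ys]"
      using cols by (simp add: componentwise_def numeral_2_eq_2)
    ultimately show "f xs \<le> f ys"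
      by auto
  qed
next
  assume R: ?R
  have "componentwise f 2 rs \<in> bool_order" if "length rs = n" "set rs \<subseteq> bool_order" for rs
  proof -
    have "list_all2 (\<le>) (map (\<lambda>r. r ! 0) rs) (map (\<lambda>r. r ! 1) rs)"
      using that(2) by (auto simp: list_all2_map1 list_all2_map2 intro!: list.rel_refl_strong)
    then have "f (map (\<lambda>r. r ! 0) rs) \<le> f (map (\<lambda>r. r ! 1) rs)"
      using R[rule_format, of "map (\<lambda>r. r ! 0) rs"] that(1) by simp
    then show ?thesis
      by (auto simp: componentwise_def numeral_2_eq_2)
  qed
  then show ?L
    by simp
qed

lemma conj_eq_definable_subset_Inv:
  "conj_eq_definable bool_order \<subseteq> Inv (Pol (2, bool_order))"
proof
  fix R assume "R \<in> conj_eq_definable bool_order"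
  then obtain m \<phi> where m: "m \<ge> 1" and vars: "\<And>\<alpha>. \<alpha> \<in> set \<phi> \<Longrightarrow> atom_vars \<alpha> \<subseteq> {..<m}"
    and R: "R = (m, {as \<in> tuples m. \<forall>\<alpha>\<in>set \<phi>. holds bool_order as \<alpha>})" (is "_ = (m, ?\<sigma>)")
    unfolding conj_eq_definable_def by auto
  have "holds bool_order (replicate m False) \<alpha>" if "\<alpha> \<in> set \<phi>" for \<alpha>
    using vars[OF that] by (cases \<alpha>) auto
  then have "replicate m False \<in> ?\<sigma>"
    by (simp add: tuples_def)
  moreover have "preserves F (m, ?\<sigma>)" if F: "F \<in> Pol (2, bool_order)" for F
  proof -
    obtain n f where [simp]: "F = (n, f)" by (cases F)
    have mono: "f xs \<le> f ys" if "length xs = n" "list_all2 (\<le>) xs ys" for xs ys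
      using F that preserves_bool_order_iff[of n f] unfolding Pol_def by auto
    have "holds bool_order (componentwise f m rs) \<alpha>"
      if "length rs = n" "set rs \<subseteq> ?\<sigma>" "\<alpha> \<in> set \<phi>" for rs \<alpha>
    proof -
      have *: "holds bool_order r \<alpha>" if "r \<in> set rs" for r
        using that \<open>set rs \<subseteq> ?\<sigma>\<close> \<open>\<alpha> \<in> set \<phi>\<close> by auto
      show ?thesis
      proof (cases \<alpha>)
        case (InRel i j)
        have "list_all2 (\<le>) (map (\<lambda>r. r ! i) rs) (map (\<lambda>r. r ! j) rs)"
          using *[OF nth_mem] InRel by (auto simp: list_all2_conv_all_nth)
        then have "f (map (\<lambda>r. r ! i) rs) \<le> f (map (\<lambda>r. r ! j) rs)"
          using mono[of "map (\<lambda>r. r ! i) rs"] that(1) by simp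
        moreover have "i < m" "j < m"
          using vars[OF that(3)] InRel by auto
        ultimately show ?thesis
          using InRel by (auto simp: componentwise_def)
      next
        case (Equal i j)
        have "map (\<lambda>r. r ! i) rs = map (\<lambda>r. r ! j) rs"
          using * Equal by auto
        moreover have "i < m" "j < m"
          using vars[OF that(3)] Equal by auto
        ultimately show ?thesis
          using Equal by (simp add: componentwise_def del: map_eq_conv)
      qed
    qed
    then show ?thesis
      by (auto simp: tuples_def componentwise_def)
  qed
  ultimately show "R \<in> Inv (Pol (2, bool_order))"
    using m unfolding R Inv_def relations_def by blast
qed

lemma conj_eq_definable_subset_gQuord:
  "conj_eq_definable bool_order \<subseteq> gQuord"
proof
  fix R assume "R \<in> conj_eq_definable bool_order"
  then obtain m \<phi> where m: "m \<ge> 1" and vars: "\<And>\<alpha>. \<alpha> \<in> set \<phi> \<Longrightarrow> atom_vars \<alpha> \<subseteq> {..<m}"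
    and R: "R = (m, {as \<in> tuples m. \<forall>\<alpha>\<in>set \<phi>. holds bool_order as \<alpha>})" (is "_ = (m, ?\<sigma>)")
    unfolding conj_eq_definable_def by auto
  have "holds bool_order (replicate m a) \<alpha>" if "\<alpha> \<in> set \<phi>" for \<alpha> a
    using vars[OF that] by (cases \<alpha>) auto
  then have "reflexive (m, ?\<sigma>)"
    by (simp add: tuples_def)
  moreover have "gen_transitive (m, ?\<sigma>)"
    unfolding gen_transitive.simps
  proof (intro allI impI, elim conjE)
    fix a :: "nat \<Rightarrow> nat \<Rightarrow> bool"
    assume rows: "\<forall>i<m. map (\<lambda>j. a i j) [0..<m] \<in> ?\<sigma>"
      and cols: "\<forall>j<m. map (\<lambda>i. a i j) [0..<m] \<in> ?\<sigma>"
    have "holds bool_order (map (\<lambda>i. a i i) [0..<m]) \<alpha>" if "\<alpha> \<in> set \<phi>" for \<alpha>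
    proof -
      have row: "holds bool_order (map (\<lambda>j. a i j) [0..<m]) \<alpha>" if "i < m" for i
        using rows that \<open>\<alpha> \<in> set \<phi>\<close> by blast
      have col: "holds bool_order (map (\<lambda>i. a i j) [0..<m]) \<alpha>" if "j < m" for j
        using cols that \<open>\<alpha> \<in> set \<phi>\<close> by blast
      show ?thesis
      proof (cases \<alpha>)
        case (InRel i j)
        then show ?thesis
          using vars[OF that] row[of i] col[of j] by (auto simp del: insert_iff)
      next
        case (Equal i j)
        then show ?thesis
          using vars[OF that] row[of i] col[of j] by auto
      qed
    qed
    then show "map (\<lambda>i. a i i) [0..<m] \<in> ?\<sigma>"
      by (simp add: tuples_def)
  qed
  ultimately show "R \<in> gQuord"
    using m unfolding R gQuord_def relations_def by blast
qed

lemma gQuord_subset_bounded_sublattices: "gQuord \<subseteq> bounded_sublattices"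
proof
  fix R :: "bool reln" assume R: "R \<in> gQuord"
  obtain m \<sigma> where [simp]: "R = (m, \<sigma>)" by (cases R)
  have rel: "(m, \<sigma>) \<in> relations" and refl: "\<And>a. replicate m a \<in> \<sigma>"
    and trans: "gen_transitive (m, \<sigma>)"
    using R by (auto simp: gQuord_def)
  have "map2 g x y \<in> \<sigma>" if x: "x \<in> \<sigma>" and y: "y \<in> \<sigma>" and "g = (\<and>) \<or> g = (\<or>)" for g x y
  proof -
    have len: "length x = m" "length y = m"
      using x y rel by (auto simp: relations_def tuples_def)
    have partial: "(\<and>) True = id" "(\<and>) False = (\<lambda>_. False)"
      "(\<or>) True = (\<lambda>_. True)" "(\<or>) False = id"
      by auto
    have g: "map (g b) z \<in> \<sigma> \<and> map (\<lambda>c. g c b) z \<in> \<sigma>" if "z \<in> \<sigma>" "length z = m" for b z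
      using \<open>g = (\<and>) \<or> g = (\<or>)\<close> that refl
      by (cases b) (auto simp: map_replicate_const partial)
    have rows: "map (\<lambda>j. g (x ! i) (y ! j)) [0..<m] = map (g (x ! i)) y" for i
      using len by (intro nth_equalityI) auto
    have cols: "map (\<lambda>i. g (x ! i) (y ! j)) [0..<m] = map (\<lambda>c. g c (y ! j)) x" for j
      using len by (intro nth_equalityI) auto
    have "map (\<lambda>i. g (x ! i) (y ! i)) [0..<m] \<in> \<sigma>"
      using trans[unfolded gen_transitive.simps, rule_format, of "\<lambda>i j. g (x ! i) (y ! j)"]
        rows cols g x y len by auto
    moreover have "map (\<lambda>i. g (x ! i) (y ! i)) [0..<m] = map2 g x y"
      using len by (intro nth_equalityI) auto
    ultimately show ?thesis
      by simp
  qed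
  then show "R \<in> bounded_sublattices"
    using rel refl by (simp add: bounded_sublattices_def)
qed

lemma restrict_in_Pol_bool_order:
  assumes "n \<ge> 1" and "\<And>xs ys. length xs = n \<Longrightarrow> list_all2 (\<le>) xs ys \<Longrightarrow> f xs \<le> f ys"
  shows "(n, restrict f (tuples n)) \<in> Pol (2, bool_order)"
proof -
  have "preserves (n, restrict f (tuples n)) (2, bool_order)"
    unfolding preserves_bool_order_iff
    using assms(2) by (auto simp: tuples_def dest: list_all2_lengthD)
  then show ?thesis
    using assms(1) by (simp add: Pol_def operations_def)
qed

lemma Inv_subset_bounded_sublattices:
  "Inv (Pol (2, bool_order)) \<subseteq> bounded_sublattices"
proof
  fix R assume R: "R \<in> Inv (Pol (2, bool_order))"
  obtain m \<sigma> where [simp]: "R = (m, \<sigma>)" by (cases R)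
  have rel: "(m, \<sigma>) \<in> relations" and "\<sigma> \<noteq> {}"
    and pres: "\<And>F. F \<in> Pol (2, bool_order) \<Longrightarrow> preserves F (m, \<sigma>)"
    using R by (auto simp: Inv_def)
  then obtain r where r: "r \<in> \<sigma>" by auto
  have const: "replicate m a \<in> \<sigma>" for a
  proof -
    let ?c = "restrict (\<lambda>_. a) (tuples 1)"
    have "(1, ?c) \<in> Pol (2, bool_order)"
      by (rule restrict_in_Pol_bool_order) auto
    from pres[OF this] have "componentwise ?c m [r] \<in> \<sigma>"
      using r by (simp only: preserves.simps) simp
    moreover have "componentwise ?c m [r] = replicate m a"
      by (simp add: componentwise_def tuples_def map_replicate_const)
    ultimately show ?thesis
      by simp
  qed
  have "map2 g x y \<in> \<sigma>" if x: "x \<in> \<sigma>" and y: "y \<in> \<sigma>" and g: "g = (\<and>) \<or> g = (\<or>)" for g x y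
  proof -
    have len: "length x = m" "length y = m"
      using x y rel by (auto simp: relations_def tuples_def)
    let ?f = "restrict (\<lambda>xs. g (xs ! 0) (xs ! 1)) (tuples 2)"
    have "(2, ?f) \<in> Pol (2, bool_order)"
      using g by (intro restrict_in_Pol_bool_order) (auto simp: list_all2_conv_all_nth)
    from pres[OF this] have "componentwise ?f m [x, y] \<in> \<sigma>"
      using x y by (simp only: preserves.simps) simp
    moreover have "componentwise ?f m [x, y] = map2 g x y"
      using len by (intro nth_equalityI) (auto simp: componentwise_def tuples_def)
    ultimately show ?thesis
      by simp
  qed
  then show "R \<in> bounded_sublattices"
    using rel const by (simp add: bounded_sublattices_def)
qed

lemma bounded_sublattice_separation:
  assumes lat: "(m, \<sigma>) \<in> bounded_sublattices" and I: "I \<subseteq> {..<m}" and J: "J \<subseteq> {..<m}"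
    and sep: "\<And>i j. i \<in> I \<Longrightarrow> j \<in> J \<Longrightarrow> \<exists>y\<in>\<sigma>. y ! i \<and> \<not> y ! j"
  shows "\<exists>z\<in>\<sigma>. (\<forall>i\<in>I. z ! i) \<and> (\<forall>j\<in>J. \<not> z ! j)"
proof -
  have const: "\<And>a. replicate m a \<in> \<sigma>" and len: "\<And>x. x \<in> \<sigma> \<Longrightarrow> length x = m"
    and meet: "\<And>x y. x \<in> \<sigma> \<Longrightarrow> y \<in> \<sigma> \<Longrightarrow> map2 (\<and>) x y \<in> \<sigma>"
    and join: "\<And>x y. x \<in> \<sigma> \<Longrightarrow> y \<in> \<sigma> \<Longrightarrow> map2 (\<or>) x y \<in> \<sigma>"
    using lat by (auto simp: bounded_sublattices_def relations_def tuples_def)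
  have "finite I" "finite J"
    using I J finite_subset by blast+
  have below: "\<exists>z\<in>\<sigma>. z ! i \<and> (\<forall>j\<in>J. \<not> z ! j)" if "i \<in> I" for i
    using \<open>finite J\<close> J sep[OF that]
  proof (induction J)
    case empty
    then show ?case
      using const[of True] I \<open>i \<in> I\<close> by (intro bexI[of _ "replicate m True"]) auto
  next
    case (insert j J)
    obtain y where "y \<in> \<sigma>" "y ! i" "\<not> y ! j"
      using insert.prems(2) by blast
    moreover obtain z where "z \<in> \<sigma>" "z ! i" "\<forall>j\<in>J. \<not> z ! j"
      using insert.IH insert.prems by blast
    ultimately show ?case
      using meet[of y z] len I \<open>i \<in> I\<close> insert.prems(1)
      by (intro bexI[of _ "map2 (\<and>) y z"]) auto
  qed
  show ?thesis
    using \<open>finite I\<close> I below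
  proof (induction I)
    case empty
    then show ?case
      using const[of False] J by (intro bexI[of _ "replicate m False"]) auto
  next
    case (insert i I)
    obtain y where "y \<in> \<sigma>" "y ! i" "\<forall>j\<in>J. \<not> y ! j"
      using insert.prems(2) by blast
    moreover obtain z where "z \<in> \<sigma>" "\<forall>i\<in>I. z ! i" "\<forall>j\<in>J. \<not> z ! j"
      using insert.IH insert.prems by blast
    ultimately show ?case
      using join[of y z] len J insert.prems(1)
      by (intro bexI[of _ "map2 (\<or>) y z"]) (auto simp: subset_iff)
  qed
qed

lemma bounded_sublattices_subset_conj_eq_definable:
  "bounded_sublattices \<subseteq> conj_eq_definable bool_order"
proof
  fix R assume R: "R \<in> bounded_sublattices"
  obtain m \<sigma> where [simp]: "R = (m, \<sigma>)" by (cases R)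
  have m: "m \<ge> 1" and len: "\<And>x. x \<in> \<sigma> \<Longrightarrow> length x = m"
    using R by (auto simp: bounded_sublattices_def relations_def tuples_def)
  define \<phi> where "\<phi> = map (\<lambda>(i, j). InRel i j)
    (filter (\<lambda>(i, j). \<forall>y\<in>\<sigma>. y ! i \<longrightarrow> y ! j) (List.product [0..<m] [0..<m]))"
  have \<phi>: "set \<phi> = {InRel i j | i j. i < m \<and> j < m \<and> (\<forall>y\<in>\<sigma>. y ! i \<longrightarrow> y ! j)}"
    by (auto simp: \<phi>_def)
  have "x \<in> \<sigma>" if x: "length x = m" and hold: "\<forall>\<alpha>\<in>set \<phi>. holds bool_order x \<alpha>" for x
  proof -
    let ?I = "{i. i < m \<and> x ! i}" and ?J = "{j. j < m \<and> \<not> x ! j}"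
    have "\<exists>y\<in>\<sigma>. y ! i \<and> \<not> y ! j" if "i \<in> ?I" "j \<in> ?J" for i j
    proof (rule ccontr)
      assume "\<not> ?thesis"
      then have "InRel i j \<in> set \<phi>"
        using that by (auto simp: \<phi>)
      with hold have "holds bool_order x (InRel i j)"
        by blast
      then show False
        using that by simp
    qed
    then obtain z where z: "z \<in> \<sigma>" "\<forall>i\<in>?I. z ! i" "\<forall>j\<in>?J. \<not> z ! j"
      using bounded_sublattice_separation[of m \<sigma> ?I ?J] R by auto
    then have "x = z"
      using x len by (intro nth_equalityI) auto
    with z(1) show ?thesis
      by simp
  qed
  moreover have "holds bool_order x \<alpha>" if "x \<in> \<sigma>" "\<alpha> \<in> set \<phi>" for x \<alpha>
    using that by (auto simp: \<phi>)
  ultimately have "\<sigma> = {as \<in> tuples m. \<forall>\<alpha>\<in>set \<phi>. holds bool_order as \<alpha>}"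
    using len by (auto simp: tuples_def simp del: insert_iff)
  moreover have "\<forall>\<alpha>\<in>set \<phi>. atom_vars \<alpha> \<subseteq> {..<m}"
    by (auto simp: \<phi>)
  ultimately show "R \<in> conj_eq_definable bool_order"
    using m unfolding conj_eq_definable_def by auto
qed

theorem theorem5p5:
  fixes \<rho> :: "bool list set" and \<M> :: "bool opn set"
  assumes "\<rho> = {[False, False], [False, True], [True, True]}"
    and "\<M> = Pol (2, \<rho>)"
  shows "gQuord = Inv \<M> \<and> Inv \<M> = conj_eq_definable \<rho>"
  unfolding assms
  using conj_eq_definable_subset_Inv conj_eq_definable_subset_gQuord
    gQuord_subset_bounded_sublattices Inv_subset_bounded_sublattices
    bounded_sublattices_subset_conj_eq_definable
  by blast

end
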